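(* Let $X$ be a symmetric Markov (Hunt) process on $E$ with generator $(A,D(A))$. Consider the Cauchy problems $$\partial_tw=Aw,\quad w_0=f\in D(A),\qquad\text{and}\qquad \mathfrak{D}^\Phi_tu=Au,\quad u_0=f\in D(A),$$ with $\Phi$ such that $$\lim_{\lambda\to0}\frac{\Phi(\lambda)}{\lambda}\in(0,\infty).$$ Then, for all $x\in E$: - if $\Phi'(0)<1$, then $\displaystyle\int_0^\infty u(t,x)\,dt<\int_0^\infty w(t,x)\,dt$; - if $\Phi'(0)>1$, then $\displaystyle\int_0^\infty u(t,x)\,dt>\int_0^\infty w(t,x)\,dt$; - if $\Phi'(0)=1$, then $\displaystyle\int_0^\infty u(t,x)\,dt=\int_0^\infty w(t,x)\,dt$.
   Context: $E$ is a locally compact separable metric space with one-point compactification $E_\partial=E\cup\{\partial\}$; $\partial$ is the cemetery point and functions $f$ on $E$ are extended by $f(\partial)=0$. $X=\{X_t\}_{t\ge0}$ is an $m$-symmetric Hunt process on $E$ with (non-positive definite, self-adjoint) generator $(A,D(A))$, associated with a regular Dirichlet form on $L^2(E)$, and semigroup $P_tf(x)=\mathbf{E}_x[f(X_t)]$. $\Phi$ is the symbol of a subordinator $H=\{H_t\}_{t\ge0}$, $H_0=0$: $\mathbf{E}_0[e^{-\lambda H_t}]=e^{-t\Phi(\lambda)}$, where $\Phi(\lambda)=\int_0^\infty(1-e^{-\lambda z})\Pi(dz)$, $\int_0^\infty(1\wedge z)\Pi(dz)<\infty$ and $\Pi((0,\infty))=\infty$. Its inverse is $L_t=\inf\{s\ge0:H_s>t\}$,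 and $X^L=X\circ L$. $\Phi'(0)$ denotes the (right) derivative at $0$, which equals $\lim_{\lambda\to0}\Phi(\lambda)/\lambda$ since $\Phi(0)=0$. For $u:[0,\infty)\to\mathbb{R}$ (piecewise) continuous with $|u(t)|\le Me^{wt}$ for some constants $M>0$, $w\ge0$, and Laplace transform $\widetilde u$, $\mathfrak{D}^\Phi_tu$ is the function with $\int_0^\infty e^{-\lambda t}\mathfrak{D}^\Phi_tu(t)\,dt=\Phi(\lambda)\widetilde u(\lambda)-\frac{\Phi(\lambda)}{\lambda}u(0)$ for $\lambda>w$. In the theorem, $w$ and $u$ denote the solutions of the two Cauchy problems, with probabilistic representations $w(t,x)=\mathbf{E}_x[f(X_t)]=P_tf(x)$ and $u(t,x)=\mathbf{E}_x[f(X^L_t)]=\int_0^\infty P_sf(x)\,\mathbf{P}_0(L_t\in ds)$.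
   Formalization: The integral of w(t,x) over time is assumed to exist (possibly infinite), and the two strict inequalities are claimed only at x where it is positive and finite; they fail otherwise, e.g. for f = 0. *)

theory Defs
  imports "HOL-Probability.Probability"
begin

text \<open>
  The state space \<open>E\<close> is a type. The cemetery \<open>\<partial>\<close> is \<open>None\<close> in the one-point compactification, which
  lives on the option type; if \<open>E\<close> is compact, \<open>None\<close> is an isolated point.
  Time ranges over \<^typ>\<open>ennreal\<close>, i.e. over \<open>[0, \<infinity>]\<close>.
\<close>

abbreviation E_del :: "'e::topological_space option topology" where
  "E_del \<equiv> Alexandroff_compactification (euclidean :: 'e topology)"

definition borel_del :: "'e::topological_space option measure" where
  "borel_del = sigma UNIV {U. openin E_del U}"

definition ext0 :: "('e \<Rightarrow> 'b::zero) \<Rightarrow> 'e option \<Rightarrow> 'b" where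
  "ext0 f y = (case y of None \<Rightarrow> 0 | Some x \<Rightarrow> f x)"


section \<open>Hunt processes\<close>

text \<open>
  The definitions follow Fukushima, Oshima and Takeda, Dirichlet Forms and Symmetric Markov
  Processes, Appendix A.2. Measurability of the kernel \<open>x \<mapsto> P x\<close> is required on all of \<open>M\<close>, which
  amounts to working with non-completed \<open>\<sigma>\<close>-algebras such as those generated by the process; the
  identities below for all \<open>P x\<close> then extend to all initial distributions by integration.
\<close>

definition sub_filtration :: "'w measure \<Rightarrow> (ennreal \<Rightarrow> 'w measure) \<Rightarrow> bool" where
  "sub_filtration M F \<longleftrightarrow> filtration (space M) F \<and> (\<forall>t. subalgebra M (F t))"

definition admissible_filtration ::
  "'w measure \<Rightarrow> ('e::metric_space option \<Rightarrow> 'w measure) \<Rightarrow> (ennreal \<Rightarrow> 'w \<Rightarrow> 'e option)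
     \<Rightarrow> (ennreal \<Rightarrow> 'w measure) \<Rightarrow> bool" where
  "admissible_filtration M P X F \<longleftrightarrow>
     sub_filtration M F \<and>
     (\<forall>t. X t \<in> F t \<rightarrow>\<^sub>M borel_del) \<and>
     (\<forall>x s t. \<forall>B\<in>sets borel_del.
        AE \<omega> in P x. real_cond_exp (P x) (F t) (indicator {\<omega>'\<in>space M. X (t + s) \<omega>' \<in> B}) \<omega>
                     = measure (P (X t \<omega>)) {\<omega>'\<in>space M. X s \<omega>' \<in> B})"

definition right_continuous_filtration :: "(ennreal \<Rightarrow> 'w measure) \<Rightarrow> bool" where
  "right_continuous_filtration F \<longleftrightarrow> (\<forall>t<\<infinity>. sets (F t) = (\<Inter>s\<in>{t<..}. sets (F s)))"

definition strong_markov ::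
  "'w measure \<Rightarrow> ('e::metric_space option \<Rightarrow> 'w measure) \<Rightarrow> (ennreal \<Rightarrow> 'w \<Rightarrow> 'e option)
     \<Rightarrow> (ennreal \<Rightarrow> 'w measure) \<Rightarrow> bool" where
  "strong_markov M P X F \<longleftrightarrow>
     (\<forall>\<sigma> x s. \<forall>B\<in>sets borel_del. stopping_time F \<sigma> \<longrightarrow>
        (AE \<omega> in P x. real_cond_exp (P x) (filtration.pre_sigma (space M) F \<sigma>)
                         (indicator {\<omega>'\<in>space M. X (\<sigma> \<omega>' + s) \<omega>' \<in> B}) \<omega>
                       = measure (P (X (\<sigma> \<omega>) \<omega>)) {\<omega>'\<in>space M. X s \<omega>' \<in> B}))"

definition quasi_left_continuous ::
  "'w measure \<Rightarrow> ('e::metric_space option \<Rightarrow> 'w measure) \<Rightarrow> (ennreal \<Rightarrow> 'w \<Rightarrow> 'e option)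
     \<Rightarrow> (ennreal \<Rightarrow> 'w measure) \<Rightarrow> bool" where
  "quasi_left_continuous M P X F \<longleftrightarrow>
     (\<forall>(\<sigma> :: nat \<Rightarrow> 'w \<Rightarrow> ennreal) x.
        (\<forall>n. stopping_time F (\<sigma> n)) \<and> (\<forall>\<omega>\<in>space M. incseq (\<lambda>n. \<sigma> n \<omega>)) \<longrightarrow>
        (AE \<omega> in P x. (SUP n. \<sigma> n \<omega>) < \<infinity> \<longrightarrow>
           limitin E_del (\<lambda>n. X (\<sigma> n \<omega>) \<omega>) (X (SUP n. \<sigma> n \<omega>) \<omega>) sequentially))"

locale markov_process =
  fixes M :: "'w measure"
    and P :: "'e::metric_space option \<Rightarrow> 'w measure"
    and X :: "ennreal \<Rightarrow> 'w \<Rightarrow> 'e option"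
  assumes kernel: "P \<in> borel_del \<rightarrow>\<^sub>M prob_algebra M"
    and X_measurable: "X t \<in> M \<rightarrow>\<^sub>M borel_del"
    and markov: "\<exists>F. admissible_filtration M P X F"
    and cemetery: "AE \<omega> in P None. X t \<omega> = None"
    and normal: "AE \<omega> in P x. X 0 \<omega> = x"
    and X_infinity: "\<omega> \<in> space M \<Longrightarrow> X \<infinity> \<omega> = None"
    and lifetime: "\<omega> \<in> space M \<Longrightarrow> X s \<omega> = None \<Longrightarrow> s \<le> t \<Longrightarrow> X t \<omega> = None"
    and shift: "\<exists>\<theta>. \<theta> \<in> space M \<rightarrow> space M \<and> (\<forall>\<omega>\<in>space M. \<forall>s. X s (\<theta> \<omega>) = X (s + t) \<omega>)"
    and right_continuous:
      "\<omega> \<in> space M \<Longrightarrow> t < \<infinity> \<Longrightarrow> limitin E_del (\<lambda>s. X s \<omega>) (X t \<omega>) (at_right t)"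
    and left_limits:
      "\<omega> \<in> space M \<Longrightarrow> 0 < t \<Longrightarrow> t < \<infinity> \<Longrightarrow> \<exists>y. limitin E_del (\<lambda>s. X s \<omega>) y (at_left t)"

locale hunt_process = markov_process +
  assumes hunt: "\<exists>F. admissible_filtration M P X F \<and> right_continuous_filtration F \<and>
                     strong_markov M P X F \<and> quasi_left_continuous M P X F"


section \<open>Symmetry, semigroup, Dirichlet form and generator\<close>

definition radon_full_support :: "'e::metric_space measure \<Rightarrow> bool" where
  "radon_full_support m \<longleftrightarrow>
     sets m = sets borel \<and> (\<forall>K. compact K \<longrightarrow> emeasure m K < \<infinity>) \<and>
     (\<forall>U. open U \<and> U \<noteq> {} \<longrightarrow> 0 < emeasure m U)"

definition m_symmetric ::
  "'e::metric_space measure \<Rightarrow> ('e option \<Rightarrow> 'w measure) \<Rightarrow> (ennreal \<Rightarrow> 'w \<Rightarrow> 'e option) \<Rightarrow> bool" where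
  "m_symmetric m P X \<longleftrightarrow>
     (\<forall>t. \<forall>f \<in> borel_measurable borel. \<forall>g \<in> borel_measurable borel.
        (\<integral>\<^sup>+x. f x * (\<integral>\<^sup>+\<omega>. ext0 g (X t \<omega>) \<partial>P (Some x)) \<partial>m)
        = (\<integral>\<^sup>+x. (\<integral>\<^sup>+\<omega>. ext0 f (X t \<omega>) \<partial>P (Some x)) * (g x :: ennreal) \<partial>m))"

definition trans_semigroup ::
  "('e option \<Rightarrow> 'w measure) \<Rightarrow> (ennreal \<Rightarrow> 'w \<Rightarrow> 'e option) \<Rightarrow> real \<Rightarrow> ('e \<Rightarrow> real) \<Rightarrow> 'e \<Rightarrow> real" where
  "trans_semigroup P X t f x = (\<integral>\<omega>. ext0 f (X (ennreal t) \<omega>) \<partial>P (Some x))"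

text \<open>
  Elements of \<open>L\<^sup>2(E, m)\<close> are represented by functions. For \<open>f \<in> L\<^sup>2\<close> the integral defining
  \<^const>\<open>trans_semigroup\<close> converges for \<open>m\<close>-almost every \<open>x\<close>.
\<close>

definition L2 :: "'e measure \<Rightarrow> ('e \<Rightarrow> real) set" where
  "L2 m = {f \<in> borel_measurable m. integrable m (\<lambda>x. (f x)\<^sup>2)}"

definition L2_tendsto :: "'e measure \<Rightarrow> ('b \<Rightarrow> 'e \<Rightarrow> real) \<Rightarrow> ('e \<Rightarrow> real) \<Rightarrow> 'b filter \<Rightarrow> bool" where
  "L2_tendsto m g h F \<longleftrightarrow> ((\<lambda>s. \<integral>\<^sup>+x. ennreal ((g s x - h x)\<^sup>2) \<partial>m) \<longlongrightarrow> 0) F"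

definition approx_form ::
  "'e measure \<Rightarrow> (real \<Rightarrow> ('e \<Rightarrow> real) \<Rightarrow> 'e \<Rightarrow> real) \<Rightarrow> real \<Rightarrow> ('e \<Rightarrow> real) \<Rightarrow> ('e \<Rightarrow> real) \<Rightarrow> real" where
  "approx_form m T t f g = (\<integral>x. (f x - T t f x) * g x \<partial>m) / t"

definition form_domain ::
  "'e measure \<Rightarrow> (real \<Rightarrow> ('e \<Rightarrow> real) \<Rightarrow> 'e \<Rightarrow> real) \<Rightarrow> ('e \<Rightarrow> real) set" where
  "form_domain m T = {f \<in> L2 m. \<exists>l. ((\<lambda>t. approx_form m T t f f) \<longlongrightarrow> l) (at_right 0)}"

definition dirichlet_form ::
  "'e measure \<Rightarrow> (real \<Rightarrow> ('e \<Rightarrow> real) \<Rightarrow> 'e \<Rightarrow> real) \<Rightarrow> ('e \<Rightarrow> real) \<Rightarrow> ('e \<Rightarrow> real) \<Rightarrow> real" where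
  "dirichlet_form m T f g = Lim (at_right 0) (\<lambda>t. approx_form m T t f g)"

definition C_c :: "('e::metric_space \<Rightarrow> real) set" where
  "C_c = {f. continuous_on UNIV f \<and> (\<exists>K. compact K \<and> (\<forall>x. x \<notin> K \<longrightarrow> f x = 0))}"

definition regular_form ::
  "'e::metric_space measure \<Rightarrow> (real \<Rightarrow> ('e \<Rightarrow> real) \<Rightarrow> 'e \<Rightarrow> real) \<Rightarrow> bool" where
  "regular_form m T \<longleftrightarrow>
     (\<forall>f\<in>form_domain m T. \<forall>\<epsilon>>0. \<exists>g\<in>form_domain m T \<inter> C_c.
        dirichlet_form m T (\<lambda>x. f x - g x) (\<lambda>x. f x - g x) + (\<integral>x. (f x - g x)\<^sup>2 \<partial>m) < \<epsilon>) \<and>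
     (\<forall>f\<in>C_c. \<forall>\<epsilon>>0. \<exists>g\<in>form_domain m T \<inter> C_c. \<forall>x. \<bar>f x - g x\<bar> < \<epsilon>)"

text \<open>\<open>generator m T f g\<close> says that \<open>f \<in> D(A)\<close> and \<open>A f = g\<close> in \<open>L\<^sup>2(E, m)\<close>.\<close>

definition generator ::
  "'e measure \<Rightarrow> (real \<Rightarrow> ('e \<Rightarrow> real) \<Rightarrow> 'e \<Rightarrow> real) \<Rightarrow> ('e \<Rightarrow> real) \<Rightarrow> ('e \<Rightarrow> real) \<Rightarrow> bool" where
  "generator m T f g \<longleftrightarrow>
     f \<in> L2 m \<and> g \<in> L2 m \<and> L2_tendsto m (\<lambda>t x. (T t f x - f x) / t) g (at_right 0)"

definition generator_domain ::
  "'e measure \<Rightarrow> (real \<Rightarrow> ('e \<Rightarrow> real) \<Rightarrow> 'e \<Rightarrow> real) \<Rightarrow> ('e \<Rightarrow> real) set" where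
  "generator_domain m T = {f. \<exists>g. generator m T f g}"


section \<open>Subordinators and their inverses\<close>

definition subordinator_symbol :: "real measure \<Rightarrow> (real \<Rightarrow> real) \<Rightarrow> bool" where
  "subordinator_symbol \<nu> \<Phi> \<longleftrightarrow>
     sets \<nu> = sets borel \<and> emeasure \<nu> {..0} = 0 \<and>
     (\<integral>\<^sup>+z. ennreal (min 1 z) \<partial>\<nu>) < \<infinity> \<and> emeasure \<nu> {0<..} = \<infinity> \<and>
     (\<forall>l\<ge>0. \<Phi> l = (\<integral>z. 1 - exp (- (l * z)) \<partial>\<nu>))"

locale subordinator = prob_space Q for Q :: "'h measure" +
  fixes H :: "real \<Rightarrow> 'h \<Rightarrow> real" and \<Phi> :: "real \<Rightarrow> real"
  assumes H_measurable: "t \<ge> 0 \<Longrightarrow> H t \<in> borel_measurable Q"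
    and H_0: "\<eta> \<in> space Q \<Longrightarrow> H 0 \<eta> = 0"
    and H_mono: "\<eta> \<in> space Q \<Longrightarrow> 0 \<le> s \<Longrightarrow> s \<le> t \<Longrightarrow> H s \<eta> \<le> H t \<eta>"
    and H_right_continuous:
      "\<eta> \<in> space Q \<Longrightarrow> 0 \<le> t \<Longrightarrow> ((\<lambda>s. H s \<eta>) \<longlongrightarrow> H t \<eta>) (at_right t)"
    and stationary_increments:
      "0 \<le> s \<Longrightarrow> s \<le> t \<Longrightarrow> distr Q borel (\<lambda>\<eta>. H t \<eta> - H s \<eta>) = distr Q borel (H (t - s))"
    and independent_increments:
      "(\<And>i. 0 \<le> \<tau> i \<and> \<tau> i \<le> \<tau> (Suc i)) \<Longrightarrow>
         indep_vars (\<lambda>_. borel) (\<lambda>i \<eta>. H (\<tau> (Suc i)) \<eta> - H (\<tau> i) \<eta>) {..<n::nat}"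
    and laplace_exponent:
      "0 \<le> t \<Longrightarrow> 0 \<le> l \<Longrightarrow> expectation (\<lambda>\<eta>. exp (- (l * H t \<eta>))) = exp (- (t * \<Phi> l))"

definition inverse_subordinator :: "(real \<Rightarrow> 'h \<Rightarrow> real) \<Rightarrow> real \<Rightarrow> 'h \<Rightarrow> ennreal" where
  "inverse_subordinator H t \<eta> = Inf {ennreal s | s. 0 \<le> s \<and> t < H s \<eta>}"


section \<open>The Cauchy problems\<close>

definition piecewise_cont :: "(real \<Rightarrow> real) \<Rightarrow> bool" where
  "piecewise_cont u \<longleftrightarrow>
     (\<forall>T>0. \<exists>S. finite S \<and> continuous_on ({0..T} - S) u \<and>
        (\<forall>s\<in>S \<inter> {0..T}. (\<exists>l. (u \<longlongrightarrow> l) (at_right s)) \<and> (0 < s \<longrightarrow> (\<exists>l. (u \<longlongrightarrow> l) (at_left s)))))"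

definition laplace_transform :: "(real \<Rightarrow> real) \<Rightarrow> real \<Rightarrow> real" where
  "laplace_transform u l = (LBINT t:{0..}. exp (- (l * t)) * u t)"

text \<open>
  \<open>has_Phi_derivative \<Phi> u v\<close> says that \<open>v\<close> is the \<open>\<Phi>\<close>-derivative of \<open>u\<close> in time; the Laplace
  transform determines \<open>v\<close> up to a null set of times.
\<close>

definition has_Phi_derivative :: "(real \<Rightarrow> real) \<Rightarrow> (real \<Rightarrow> real) \<Rightarrow> (real \<Rightarrow> real) \<Rightarrow> bool" where
  "has_Phi_derivative \<Phi> u v \<longleftrightarrow>
     piecewise_cont u \<and>
     (\<exists>K>0. \<exists>w\<ge>0. (\<forall>t\<ge>0. \<bar>u t\<bar> \<le> K * exp (w * t)) \<and>
        (\<forall>l>w. set_integrable lborel {0..} (\<lambda>t. exp (- (l * t)) * v t) \<and>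
               laplace_transform v l = \<Phi> l * laplace_transform u l - \<Phi> l / l * u 0))"

text \<open>
  \<open>A\<close> is an operator on \<open>L\<^sup>2(E, m)\<close>: in the first problem the time derivative is the derivative of
  an \<open>L\<^sup>2\<close>-valued function, in the second one the \<open>\<Phi>\<close>-derivative is taken for \<open>m\<close>-almost every \<open>x\<close>.
\<close>

definition solves_heat ::
  "'e measure \<Rightarrow> (real \<Rightarrow> ('e \<Rightarrow> real) \<Rightarrow> 'e \<Rightarrow> real) \<Rightarrow> ('e \<Rightarrow> real) \<Rightarrow> (real \<Rightarrow> 'e \<Rightarrow> real) \<Rightarrow> bool" where
  "solves_heat m T f w \<longleftrightarrow>
     w 0 = f \<and>
     (\<forall>t\<ge>0. \<exists>v. generator m T (w t) v \<and>
        L2_tendsto m (\<lambda>s x. (w s x - w t x) / (s - t)) v (at t within {0..}))"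

definition solves_Phi_heat ::
  "'e measure \<Rightarrow> (real \<Rightarrow> ('e \<Rightarrow> real) \<Rightarrow> 'e \<Rightarrow> real) \<Rightarrow> (real \<Rightarrow> real) \<Rightarrow> ('e \<Rightarrow> real)
     \<Rightarrow> (real \<Rightarrow> 'e \<Rightarrow> real) \<Rightarrow> bool" where
  "solves_Phi_heat m T \<Phi> f u \<longleftrightarrow>
     u 0 = f \<and>
     (\<exists>v. (\<forall>t>0. generator m T (u t) (v t)) \<and>
          (AE x in m. has_Phi_derivative \<Phi> (\<lambda>t. u t x) (\<lambda>t. v t x)))"


section \<open>Integrals over all times\<close>

text \<open>
  Extended-real Lebesgue integral over \<open>[0, \<infinity>)\<close>; it is meaningful if the positive or the
  negative part has a finite integral.
\<close>

definition has_time_integral :: "(real \<Rightarrow> real) \<Rightarrow> bool" where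
  "has_time_integral g \<longleftrightarrow>
     set_borel_measurable lborel {0..} g \<and>
     ((\<integral>\<^sup>+t\<in>{0..}. ennreal (g t) \<partial>lborel) < \<infinity> \<or> (\<integral>\<^sup>+t\<in>{0..}. ennreal (- g t) \<partial>lborel) < \<infinity>)"

definition time_integral :: "(real \<Rightarrow> real) \<Rightarrow> ereal" where
  "time_integral g =
     enn2ereal (\<integral>\<^sup>+t\<in>{0..}. ennreal (g t) \<partial>lborel) - enn2ereal (\<integral>\<^sup>+t\<in>{0..}. ennreal (- g t) \<partial>lborel)"

end

theory Submission
  imports Defs
begin

text \<open>
  By Fubini, \<open>u(t, x)\<close> is the expectation of \<open>w(L\<^sub>t, x)\<close> over the subordinator. The set of times
  \<open>t \<ge> 0\<close> with \<open>L\<^sub>t \<le> s\<close> has length \<open>H\<^sub>s\<close>, and \<open>H\<^sub>s\<close> has mean \<open>s \<Phi>'(0)\<close>. Hence the mean occupation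
  measure of \<open>L\<close> is \<open>\<Phi>'(0)\<close> times Lebesgue measure on \<open>[0, \<infinity>)\<close>, so that the time integral of
  \<open>u(\<cdot>, x)\<close> is \<open>\<Phi>'(0)\<close> times that of \<open>w(\<cdot>, x)\<close>.
\<close>

section \<open>Path properties of the inverse subordinator\<close>

context subordinator
begin

lemma H_nonneg: "\<eta> \<in> space Q \<Longrightarrow> 0 \<le> t \<Longrightarrow> 0 \<le> H t \<eta>"
  using H_mono[of \<eta> 0 t] H_0 by simp

text \<open>Since paths are nondecreasing, every rational above an admissible time is admissible
  too, and rationals come arbitrarily close from above. The countable infimum is what makes joint
  measurability in time and path accessible.\<close>

lemma inverse_subordinator_eq_INF_Rats:
  assumes \<eta>: "\<eta> \<in> space Q"
  shows "inverse_subordinator H t \<eta> = (INF r\<in>{r\<in>\<rat>. 0 \<le> r}. if t < H r \<eta> then ennreal r else \<infinity>)"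
    (is "_ = ?I")
proof (rule antisym)
  show "inverse_subordinator H t \<eta> \<le> ?I"
    unfolding inverse_subordinator_def by (rule INF_greatest) (auto intro!: Inf_lower)
  show "?I \<le> inverse_subordinator H t \<eta>"
    unfolding inverse_subordinator_def
  proof (rule Inf_greatest, clarify)
    fix s assume s: "0 \<le> s" "t < H s \<eta>"
    show "?I \<le> ennreal s"
    proof (rule dense_ge)
      fix y assume y: "ennreal s < y"
      show "?I \<le> y"
      proof (cases y)
        case (real y')
        then have "s < y'" using y s by (simp add: ennreal_less_iff)
        then obtain r where r: "r \<in> \<rat>" "s < r" "r < y'" using Rats_dense_in_real by blast
        have "t < H r \<eta>" using H_mono[OF \<eta>, of s r] s r by simp
        then have "?I \<le> ennreal r"
          using r s by (intro INF_lower2[of r]) auto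
        also have "\<dots> \<le> y" using r real by (simp add: ennreal_leI)
        finally show ?thesis .
      qed simp
    qed
  qed
qed

lemma measurable_inverse_subordinator:
  "(\<lambda>(t, \<eta>). inverse_subordinator H t \<eta>) \<in> borel_measurable (borel \<Otimes>\<^sub>M Q)"
proof -
  have "(\<lambda>(t, \<eta>). INF r\<in>{r\<in>\<rat>. 0 \<le> r}. if t < H r \<eta> then ennreal r else \<infinity>)
      \<in> borel_measurable (borel \<Otimes>\<^sub>M Q)"
    unfolding case_prod_beta
  proof (rule borel_measurable_INF)
    show "countable {r::real \<in> \<rat>. 0 \<le> r}"
      by (rule countable_subset[OF _ countable_rat]) auto
    fix r :: real assume "r \<in> {r \<in> \<rat>. 0 \<le> r}"
    then have [measurable]: "H r \<in> borel_measurable Q" using H_measurable by auto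
    show "(\<lambda>x. if fst x < H r (snd x) then ennreal r else \<infinity>) \<in> borel_measurable (borel \<Otimes>\<^sub>M Q)"
      by measurable
  qed
  then show ?thesis
    by (rule measurable_cong[THEN iffD1, rotated])
       (auto simp: space_pair_measure inverse_subordinator_eq_INF_Rats)
qed

text \<open>If the path is below \<open>t\<close> at time \<open>s\<close>, right-continuity keeps
  it below \<open>t\<close> up to some \<open>b > s\<close>, and monotonicity does so before
  \<open>s\<close>. The first passage above \<open>t\<close> then comes no earlier than
  \<open>b\<close>.\<close>

lemma inverse_subordinator_le_imp_le:
  assumes \<eta>: "\<eta> \<in> space Q" and s: "0 \<le> s" and le: "inverse_subordinator H t \<eta> \<le> ennreal s"
  shows "t \<le> H s \<eta>"
proof (rule ccontr)
  assume "\<not> t \<le> H s \<eta>"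
  then have lt: "H s \<eta> < t" by simp
  then have "eventually (\<lambda>r. H r \<eta> < t) (at_right s)"
    using order_tendstoD(2)[OF H_right_continuous[OF \<eta> s]] by blast
  then obtain b where b: "b > s" "\<And>r. s < r \<Longrightarrow> r < b \<Longrightarrow> H r \<eta> < t"
    unfolding eventually_at_right_field by blast
  have "ennreal b \<le> inverse_subordinator H t \<eta>"
    unfolding inverse_subordinator_def
  proof (rule Inf_greatest, clarify)
    fix r assume r: "0 \<le> r" "t < H r \<eta>"
    have "\<not> r \<le> s" using H_mono[OF \<eta>, of r s] r lt by auto
    then have "b \<le> r" using b(2)[of r] r by (meson linorder_not_less not_less_iff_gr_or_eq)
    then show "ennreal b \<le> ennreal r" by (rule ennreal_leI)
  qed
  with le have "ennreal b \<le> ennreal s" by (rule order_trans[rotated])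
  with b s show False by simp
qed

text \<open>The set lies between [0, H_s) and [0, H_s]. The end point H_s is missing when the path
  stays constant just after \<open>s\<close>, but it has length zero.\<close>

lemma emeasure_inverse_subordinator_le:
  assumes \<eta>: "\<eta> \<in> space Q" and s: "0 \<le> s"
  shows "emeasure lborel {t. 0 \<le> t \<and> inverse_subordinator H t \<eta> \<le> ennreal s} = ennreal (H s \<eta>)"
    (is "emeasure _ ?A = _")
proof (rule antisym)
  have [measurable]: "(\<lambda>t. inverse_subordinator H t \<eta>) \<in> borel_measurable borel"
    using measurable_compose[OF measurable_Pair2'[OF \<eta>] measurable_inverse_subordinator] by simp
  have A: "?A \<in> sets borel" by measurable
  have nn: "0 \<le> H s \<eta>" using H_nonneg[OF \<eta> s] .
  have "emeasure lborel ?A \<le> emeasure lborel {0..H s \<eta>}"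
    using inverse_subordinator_le_imp_le[OF \<eta> s] by (intro emeasure_mono) auto
  then show "emeasure lborel ?A \<le> ennreal (H s \<eta>)" using nn by simp
  have "emeasure lborel {0..<H s \<eta>} \<le> emeasure lborel ?A"
    using A s by (intro emeasure_mono) (auto simp: inverse_subordinator_def intro!: Inf_lower)
  then show "ennreal (H s \<eta>) \<le> emeasure lborel ?A" using nn by simp
qed

section \<open>Mean of the subordinator\<close>

lemma nn_integral_H:
  assumes s: "0 \<le> s" and deriv: "(\<Phi> has_real_derivative d) (at 0 within {0..})"
    and \<Phi>0: "\<Phi> 0 = 0" and d: "0 \<le> d"
  shows "(\<integral>\<^sup>+\<eta>. ennreal (H s \<eta>) \<partial>Q) = ennreal (s * d)"
proof (rule antisym)
  \<comment> \<open>The difference quotients of \<open>1 - exp (- l H\<^sub>s)\<close> are dominated by their limit \<open>H\<^sub>s\<close>, which bounds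
    the mean of \<open>H\<^sub>s\<close> from below; Fatou's lemma gives the other bound.\<close>
  have [measurable]: "H s \<in> borel_measurable Q" using H_measurable[OF s] .
  \<comment> \<open>Fatou's lemma is for sequences, so 0 is approached along a sequence; its
    positive terms can serve as denominators of the difference quotients.\<close>
  define l where "l n = inverse (real (Suc n))" for n
  have l: "l \<longlonglongrightarrow> 0" "l n > 0" for n
    using LIMSEQ_inverse_real_of_nat unfolding l_def by auto
  have lfil: "filterlim l (at 0 within {0..}) sequentially"
    using l by (auto simp: filterlim_at intro!: always_eventually less_imp_le) (metis less_irrefl)
  define q where "q n \<eta> = (1 - exp (- (l n * H s \<eta>))) / l n" for n \<eta>
  have q_meas [measurable]: "q n \<in> borel_measurable Q" for n
    unfolding q_def by measurable
  have q_nonneg: "0 \<le> q n \<eta>" if "\<eta> \<in> space Q" for n \<eta>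
    using H_nonneg[OF that s] l(2)[of n] by (auto simp: q_def intro!: divide_nonneg_pos)
  have q_le: "q n \<eta> \<le> H s \<eta>" if "\<eta> \<in> space Q" for n \<eta>
  proof -
    have "1 - exp (- (l n * H s \<eta>)) \<le> l n * H s \<eta>"
      using exp_ge_add_one_self[of "- (l n * H s \<eta>)"] by simp
    then show ?thesis using l(2)[of n] by (simp add: q_def divide_le_eq mult.commute)
  qed
  have q_lim: "(\<lambda>n. q n \<eta>) \<longlonglongrightarrow> H s \<eta>" for \<eta>
  proof -
    have "((\<lambda>l. - exp (- (l * H s \<eta>))) has_real_derivative H s \<eta>) (at 0 within {0..})"
      by (auto intro!: derivative_eq_intros)
    then have "((\<lambda>l. (1 - exp (- (l * H s \<eta>))) / l) \<longlongrightarrow> H s \<eta>) (at 0 within {0..})"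
      by (simp add: has_field_derivative_iff)
    from filterlim_compose[OF this lfil] show ?thesis by (simp add: q_def)
  qed
  have int: "integrable Q (\<lambda>\<eta>. exp (- (l n * H s \<eta>)))" for n
    using H_nonneg[OF _ s] l(2)[of n]
    by (intro integrable_const_bound[where B=1]) (auto intro!: AE_I2)
  have q_int: "(\<integral>\<^sup>+\<eta>. ennreal (q n \<eta>) \<partial>Q) = ennreal ((1 - exp (- (s * \<Phi> (l n)))) / l n)" for n
  proof -
    have "expectation (q n) = (1 - expectation (\<lambda>\<eta>. exp (- (l n * H s \<eta>)))) / l n"
      unfolding q_def using int[of n] by (simp add: prob_space)
    also have "\<dots> = (1 - exp (- (s * \<Phi> (l n)))) / l n"
      using laplace_exponent[OF s, of "l n"] l(2)[of n] by simp
    moreover have "integrable Q (q n)"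
      unfolding q_def using int[of n] by simp
    ultimately show ?thesis
      using q_nonneg by (subst nn_integral_eq_integral) (auto intro!: AE_I2)
  qed
  \<comment> \<open>By the Laplace exponent, the means of \<open>q n\<close> are difference
    quotients at 0 of 1 - exp(- s \<Phi>). The chain rule gives their limit \<open>s * d\<close>, as
    \<Phi> vanishes at 0.\<close>
  have "((\<lambda>l. - exp (- (s * \<Phi> l))) has_real_derivative s * d) (at 0 within {0..})"
    using deriv by (auto intro!: derivative_eq_intros simp: \<Phi>0)
  then have "((\<lambda>l. (1 - exp (- (s * \<Phi> l))) / l) \<longlongrightarrow> s * d) (at 0 within {0..})"
    by (simp add: has_field_derivative_iff \<Phi>0)
  from filterlim_compose[OF this lfil]
  have lim: "(\<lambda>n. \<integral>\<^sup>+\<eta>. ennreal (q n \<eta>) \<partial>Q) \<longlonglongrightarrow> ennreal (s * d)"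
    unfolding q_int by (rule tendsto_ennrealI)
  have "(\<integral>\<^sup>+\<eta>. ennreal (H s \<eta>) \<partial>Q) = (\<integral>\<^sup>+\<eta>. liminf (\<lambda>n. ennreal (q n \<eta>)) \<partial>Q)"
    by (intro nn_integral_cong lim_imp_Liminf[symmetric] tendsto_ennrealI q_lim) simp
  also have "\<dots> \<le> liminf (\<lambda>n. \<integral>\<^sup>+\<eta>. ennreal (q n \<eta>) \<partial>Q)"
    by (rule nn_integral_liminf) measurable
  also have "\<dots> = ennreal (s * d)"
    by (rule lim_imp_Liminf[OF _ lim]) simp
  finally show "(\<integral>\<^sup>+\<eta>. ennreal (H s \<eta>) \<partial>Q) \<le> ennreal (s * d)" .
  show "ennreal (s * d) \<le> (\<integral>\<^sup>+\<eta>. ennreal (H s \<eta>) \<partial>Q)"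
    by (rule LIMSEQ_le_const2[OF lim]) (auto intro!: nn_integral_mono ennreal_leI q_le)
qed

section \<open>Mean occupation measure of the inverse\<close>

text \<open>Both sides integrate \<open>g\<close> against a measure on the line, so it is enough to
  compare these measures on half-lines. There the length of a sublevel set of \<open>L\<close> is
  H_s, whose mean is \<open>s * d\<close>.\<close>

lemma nn_integral_inverse_subordinator:
  fixes g :: "real \<Rightarrow> ennreal"
  assumes deriv: "(\<Phi> has_real_derivative d) (at 0 within {0..})"
    and \<Phi>0: "\<Phi> 0 = 0" and d: "0 \<le> d"
    and g [measurable]: "g \<in> borel_measurable borel"
  defines "L \<equiv> inverse_subordinator H"
  shows "(\<integral>\<^sup>+t\<in>{0..}. (\<integral>\<^sup>+\<eta>. g (enn2real (L t \<eta>)) * indicator {..<\<infinity>} (L t \<eta>) \<partial>Q) \<partial>lborel)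
       = ennreal d * (\<integral>\<^sup>+s\<in>{0..}. g s \<partial>lborel)"
proof -
  have sigma_finite_Q: "sigma_finite_measure Q" ..
  interpret pair_sigma_finite lborel Q ..
  have L [measurable]: "(\<lambda>z. L (fst z) (snd z)) \<in> borel_measurable (lborel \<Otimes>\<^sub>M Q)"
    using measurable_inverse_subordinator unfolding L_def case_prod_beta by simp
  \<comment> \<open>The second factor removes pairs with infinite \<open>L\<close>:
    \<open>enn2real\<close> maps \<infinity> to 0, so they would otherwise put spurious mass at
    0.\<close>
  define k where "k z = indicator {0..} (fst z) * (indicator {..<\<infinity>} (L (fst z) (snd z)) :: ennreal)" for z
  have k [measurable]: "k \<in> borel_measurable (lborel \<Otimes>\<^sub>M Q)"
    unfolding k_def by measurable
  \<comment> \<open>\<open>N1\<close> is the mean occupation measure of the inverse, and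
    \<open>N2\<close> is \<open>d\<close> times Lebesgue measure on the half-line.\<close>
  define N1 where "N1 = distr (density (lborel \<Otimes>\<^sub>M Q) k) borel (\<lambda>z. enn2real (L (fst z) (snd z)))"
  define N2 where "N2 = density lborel (\<lambda>s::real. ennreal d * indicator {0..} s)"
  have N1_le: "emeasure N1 {..s} = ennreal (d * max 0 s)" for s
  proof -
    have "(\<lambda>z. enn2real (L (fst z) (snd z))) \<in> borel_measurable (lborel \<Otimes>\<^sub>M Q)"
      by measurable
    then have S: "(\<lambda>z. enn2real (L (fst z) (snd z))) -` {..s} \<inter> space (lborel \<Otimes>\<^sub>M Q) \<in> sets (lborel \<Otimes>\<^sub>M Q)"
      by (rule measurable_sets) simp
    have "emeasure N1 {..s} =
        (\<integral>\<^sup>+z. k z * indicator {..s} (enn2real (L (fst z) (snd z))) \<partial>(lborel \<Otimes>\<^sub>M Q))"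
      unfolding N1_def
      by (subst emeasure_distr, simp, simp, subst emeasure_density)
         (use S in \<open>auto intro!: nn_integral_cong split: split_indicator\<close>)
    \<comment> \<open>Tonelli puts time inside, so that the length of the sublevel set can be
      inserted path by path.\<close>
    also have "\<dots> = (\<integral>\<^sup>+\<eta>. \<integral>\<^sup>+t. k (t, \<eta>) * indicator {..s} (enn2real (L t \<eta>)) \<partial>lborel \<partial>Q)"
      by (subst nn_integral_snd[symmetric]) (auto simp: case_prod_beta)
    also have "\<dots> = (\<integral>\<^sup>+\<eta>. ennreal (if 0 \<le> s then H s \<eta> else 0) \<partial>Q)"
    proof (rule nn_integral_cong)
      fix \<eta> assume \<eta>: "\<eta> \<in> space Q"
      have [measurable]: "(\<lambda>t. L t \<eta>) \<in> borel_measurable borel"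
        using measurable_compose[OF measurable_Pair2'[OF \<eta>] measurable_inverse_subordinator]
        by (simp add: L_def)
      \<comment> \<open>The conjunct \<open>0 \<le> s\<close> is there because
        \<open>enn2real\<close> is never negative: for \<open>s < 0\<close> the set is
        empty.\<close>
      have "(\<integral>\<^sup>+t. k (t, \<eta>) * indicator {..s} (enn2real (L t \<eta>)) \<partial>lborel)
          = (\<integral>\<^sup>+t. indicator {t. 0 \<le> t \<and> 0 \<le> s \<and> L t \<eta> \<le> ennreal s} t \<partial>lborel)"
      proof (rule nn_integral_cong)
        fix t
        show "k (t, \<eta>) * indicator {..s} (enn2real (L t \<eta>))
            = indicator {t. 0 \<le> t \<and> 0 \<le> s \<and> L t \<eta> \<le> ennreal s} t"
          by (cases "L t \<eta>") (auto simp: k_def ennreal_le_iff2 top_unique split: split_indicator)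
      qed
      also have "\<dots> = emeasure lborel {t. 0 \<le> t \<and> 0 \<le> s \<and> L t \<eta> \<le> ennreal s}"
        by (rule nn_integral_indicator) measurable
      also have "\<dots> = ennreal (if 0 \<le> s then H s \<eta> else 0)"
        using emeasure_inverse_subordinator_le[OF \<eta>, of s] by (auto simp: L_def)
      finally show "(\<integral>\<^sup>+t. k (t, \<eta>) * indicator {..s} (enn2real (L t \<eta>)) \<partial>lborel) = \<dots>" .
    qed
    also have "\<dots> = ennreal (d * max 0 s)"
      using nn_integral_H[OF _ deriv \<Phi>0 d, of s] by (auto simp: max_def mult.commute)
    finally show ?thesis .
  qed
  have N2_le: "emeasure N2 {..s} = ennreal (d * max 0 s)" for s
  proof -
    have "emeasure N2 {..s} = (\<integral>\<^sup>+x. ennreal d * indicator {0..s} x \<partial>lborel)"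
      unfolding N2_def by (subst emeasure_density) (auto intro!: nn_integral_cong split: split_indicator)
    also have "\<dots> = ennreal (d * max 0 s)"
      using d by (auto simp: nn_integral_cmult max_def ennreal_mult')
    finally show ?thesis .
  qed
  \<comment> \<open>Half-lines form an intersection-stable generator of the Borel sets. Both
    measures are finite on the sets \<open>{..real n}\<close>, which exhaust the line.\<close>
  have "N1 = N2"
  proof (rule measure_eqI_generator_eq[where E="range atMost" and \<Omega>=UNIV and A="\<lambda>n::nat. {..real n}"])
    show "Int_stable (range (atMost :: real \<Rightarrow> _))"
      by (auto simp: Int_stable_def)
    show "sets N1 = sigma_sets UNIV (range atMost)" "sets N2 = sigma_sets UNIV (range atMost)"
      by (auto simp: N1_def N2_def borel_eq_atMost)
    show "(\<Union>n::nat. {..real n}) = UNIV"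
      by (auto intro: real_arch_simple)
  qed (auto simp: N1_le N2_le)
  then have "(\<integral>\<^sup>+s. g s \<partial>N1) = (\<integral>\<^sup>+s. g s \<partial>N2)" by simp
  moreover have "(\<integral>\<^sup>+s. g s \<partial>N1) = (\<integral>\<^sup>+z. k z * g (enn2real (L (fst z) (snd z))) \<partial>(lborel \<Otimes>\<^sub>M Q))"
    unfolding N1_def by (subst nn_integral_distr) (auto simp: nn_integral_density)
  moreover have "\<dots> = (\<integral>\<^sup>+t. \<integral>\<^sup>+\<eta>. k (t, \<eta>) * g (enn2real (L t \<eta>)) \<partial>Q \<partial>lborel)"
    using sigma_finite_measure.nn_integral_fst[OF sigma_finite_Q,
        of "\<lambda>z. k z * g (enn2real (L (fst z) (snd z)))" lborel] by simp
  moreover have "\<dots> = (\<integral>\<^sup>+t\<in>{0..}. (\<integral>\<^sup>+\<eta>. g (enn2real (L t \<eta>)) * indicator {..<\<infinity>} (L t \<eta>) \<partial>Q) \<partial>lborel)"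
    by (intro nn_integral_cong) (auto simp: k_def mult.commute split: split_indicator)
  moreover have "(\<integral>\<^sup>+s. g s \<partial>N2) = (\<integral>\<^sup>+s. ennreal d * (g s * indicator {0..} s) \<partial>lborel)"
    unfolding N2_def by (subst nn_integral_density) (auto simp: ac_simps)
  moreover have "\<dots> = ennreal d * (\<integral>\<^sup>+s\<in>{0..}. g s \<partial>lborel)"
    by (rule nn_integral_cmult) measurable
  ultimately show ?thesis by simp
qed

end

section \<open>Positive and negative parts of integrals\<close>

text \<open>This is the difference formula for the integral with all negative terms moved across,
  because subtraction on \<open>ennreal\<close> truncates. In this form it can be integrated over a
  further variable even if the results are infinite.\<close>

lemma nn_integral_pos_neg_part:
  fixes v :: "'a \<Rightarrow> real"
  assumes "integrable M v"
  shows "ennreal (\<integral>x. v x \<partial>M) + (\<integral>\<^sup>+x. ennreal (- v x) \<partial>M)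
       = ennreal (- (\<integral>x. v x \<partial>M)) + (\<integral>\<^sup>+x. ennreal (v x) \<partial>M)"
proof -
  have fin: "(\<integral>\<^sup>+x. ennreal (v x) \<partial>M) < \<infinity>" "(\<integral>\<^sup>+x. ennreal (- v x) \<partial>M) < \<infinity>"
    using assms by (auto simp: real_integrable_def less_top)
  obtain a where a: "(\<integral>\<^sup>+x. ennreal (v x) \<partial>M) = ennreal a" "0 \<le> a"
    using fin(1) by (cases "\<integral>\<^sup>+x. ennreal (v x) \<partial>M") auto
  obtain b where b: "(\<integral>\<^sup>+x. ennreal (- v x) \<partial>M) = ennreal b" "0 \<le> b"
    using fin(2) by (cases "\<integral>\<^sup>+x. ennreal (- v x) \<partial>M") auto
  have "(\<integral>x. v x \<partial>M) = a - b"
    using real_lebesgue_integral_def[OF assms] a b by simp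
  then show ?thesis
    using a b by (cases "a \<le> b") (auto simp: ennreal_neg simp flip: ennreal_plus)
qed

lemma ennreal_integral_le_nn_integral:
  fixes v :: "'a \<Rightarrow> real"
  assumes "integrable M v"
  shows "ennreal (\<integral>x. v x \<partial>M) \<le> (\<integral>\<^sup>+x. ennreal (v x) \<partial>M)"
proof (cases "0 \<le> (\<integral>x. v x \<partial>M)")
  case True
  have "ennreal (\<integral>x. v x \<partial>M) \<le> ennreal (\<integral>x. v x \<partial>M) + (\<integral>\<^sup>+x. ennreal (- v x) \<partial>M)"
    by simp
  also have "\<dots> = (\<integral>\<^sup>+x. ennreal (v x) \<partial>M)"
    using nn_integral_pos_neg_part[OF assms] True by (simp add: ennreal_neg)
  finally show ?thesis .
qed (simp add: ennreal_neg)

text \<open>Only one part of \<open>w\<close> need have a finite time integral, so Fubini for signed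
  integrable functions does not apply. The occupation formula is used for the positive and the
  negative part separately, and the results are then combined without subtracting
  infinities.\<close>

lemma (in subordinator) time_integral_subordinated:
  fixes w u :: "real \<Rightarrow> real"
  assumes deriv: "(\<Phi> has_real_derivative d) (at 0 within {0..})"
    and \<Phi>0: "\<Phi> 0 = 0" and d: "0 < d"
    and w: "has_time_integral w"
    and u: "\<And>t. 0 \<le> t \<Longrightarrow> has_bochner_integral Q
      (\<lambda>\<eta>. if inverse_subordinator H t \<eta> < \<infinity> then w (enn2real (inverse_subordinator H t \<eta>)) else 0) (u t)"
  shows "has_time_integral u" and "time_integral u = ereal d * time_integral w"
proof -
  define L where "L = inverse_subordinator H"
  \<comment> \<open>Measurability of \<open>w\<close> is given only on [0, \<infinity>). The cut-off
    changes nothing along \<open>L\<close>, since \<open>enn2real\<close> takes values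
    there.\<close>
  define g where "g s = indicator {0..} s * w s" for s
  have g [measurable]: "g \<in> borel_measurable borel"
    using w by (simp add: has_time_integral_def set_borel_measurable_def g_def[abs_def])
  have L [measurable]: "(\<lambda>z. L (fst z) (snd z)) \<in> borel_measurable (borel \<Otimes>\<^sub>M Q)"
    using measurable_inverse_subordinator unfolding L_def case_prod_beta .
  define v where "v t \<eta> = (if L t \<eta> < \<infinity> then g (enn2real (L t \<eta>)) else 0)" for t \<eta>
  have v [measurable]: "(\<lambda>(t, \<eta>). v t \<eta>) \<in> borel_measurable (borel \<Otimes>\<^sub>M Q)"
    unfolding v_def case_prod_beta by measurable
  have v_int: "integrable Q (v t)" "u t = (\<integral>\<eta>. v t \<eta> \<partial>Q)" if "0 \<le> t" for t
  proof -
    have "has_bochner_integral Q (v t) (u t)"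
      using u[OF that] by (simp add: v_def[abs_def] g_def L_def cong: if_cong)
    then show "integrable Q (v t)" "u t = (\<integral>\<eta>. v t \<eta> \<partial>Q)"
      by (auto simp: has_bochner_integral_iff)
  qed
  define U where "U t = indicator {0..} t * u t" for t
  \<comment> \<open>Writing \<open>u\<close> as a parameter integral over paths yields its
    measurability in time.\<close>
  have U: "U = (\<lambda>t. indicator {0..} t * (\<integral>\<eta>. v t \<eta> \<partial>Q))"
    using v_int(2) by (auto simp: U_def fun_eq_iff split: split_indicator)
  have [measurable]: "U \<in> borel_measurable borel"
    unfolding U by measurable
  \<comment> \<open>\<open>p\<close> and \<open>n\<close> are the means of the parts of w(L_t). They
    can exceed the parts of \<open>u t\<close>, because the expectation may cancel.\<close>
  define p where "p t = (\<integral>\<^sup>+\<eta>. ennreal (v t \<eta>) \<partial>Q)" for t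
  define n where "n t = (\<integral>\<^sup>+\<eta>. ennreal (- v t \<eta>) \<partial>Q)" for t
  have [measurable]: "p \<in> borel_measurable borel" "n \<in> borel_measurable borel"
    unfolding p_def n_def by measurable
  define a b a' b' where "a = (\<integral>\<^sup>+t\<in>{0..}. ennreal (w t) \<partial>lborel)"
    and "b = (\<integral>\<^sup>+t\<in>{0..}. ennreal (- w t) \<partial>lborel)"
    and "a' = (\<integral>\<^sup>+t\<in>{0..}. ennreal (u t) \<partial>lborel)"
    and "b' = (\<integral>\<^sup>+t\<in>{0..}. ennreal (- u t) \<partial>lborel)"
  note ab = a_def b_def a'_def b'_def
  have U_a: "a' = (\<integral>\<^sup>+t. ennreal (U t) \<partial>lborel)" "b' = (\<integral>\<^sup>+t. ennreal (- U t) \<partial>lborel)"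
    by (auto simp: ab U_def intro!: nn_integral_cong split: split_indicator)
  have p_int: "(\<integral>\<^sup>+t\<in>{0..}. p t \<partial>lborel) = ennreal d * a"
  proof -
    have "(\<integral>\<^sup>+t\<in>{0..}. p t \<partial>lborel) =
        (\<integral>\<^sup>+t\<in>{0..}. (\<integral>\<^sup>+\<eta>. ennreal (g (enn2real (L t \<eta>))) * indicator {..<\<infinity>} (L t \<eta>) \<partial>Q) \<partial>lborel)"
      unfolding p_def v_def by (auto intro!: nn_integral_cong split: split_indicator)
    also have "\<dots> = ennreal d * (\<integral>\<^sup>+s\<in>{0..}. ennreal (g s) \<partial>lborel)"
      unfolding L_def using d by (intro nn_integral_inverse_subordinator[OF deriv \<Phi>0]) auto
    also have "(\<integral>\<^sup>+s\<in>{0..}. ennreal (g s) \<partial>lborel) = a"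
      unfolding ab g_def by (auto intro!: nn_integral_cong split: split_indicator)
    finally show ?thesis .
  qed
  have n_int: "(\<integral>\<^sup>+t\<in>{0..}. n t \<partial>lborel) = ennreal d * b"
  proof -
    have "(\<integral>\<^sup>+t\<in>{0..}. n t \<partial>lborel) =
        (\<integral>\<^sup>+t\<in>{0..}. (\<integral>\<^sup>+\<eta>. ennreal (- g (enn2real (L t \<eta>))) * indicator {..<\<infinity>} (L t \<eta>) \<partial>Q) \<partial>lborel)"
      unfolding n_def v_def by (auto intro!: nn_integral_cong split: split_indicator)
    also have "\<dots> = ennreal d * (\<integral>\<^sup>+s\<in>{0..}. ennreal (- g s) \<partial>lborel)"
      unfolding L_def using d by (intro nn_integral_inverse_subordinator[OF deriv \<Phi>0]) auto
    also have "(\<integral>\<^sup>+s\<in>{0..}. ennreal (- g s) \<partial>lborel) = b"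
      unfolding ab g_def by (auto intro!: nn_integral_cong split: split_indicator)
    finally show ?thesis .
  qed
  have a'_le: "a' \<le> ennreal d * a"
    unfolding p_int[symmetric] a'_def p_def
    using ennreal_integral_le_nn_integral[OF v_int(1)]
    by (auto intro!: nn_integral_mono simp: v_int(2) split: split_indicator)
  have b'_le: "b' \<le> ennreal d * b"
    unfolding n_int[symmetric] b'_def n_def
    using ennreal_integral_le_nn_integral[OF integrable_minus[OF v_int(1)]]
    by (auto intro!: nn_integral_mono simp: v_int(2) split: split_indicator)
  \<comment> \<open>The pointwise balance of parts is integrated over time; the cancelled amount
    drops out of the comparison.\<close>
  have "a' + ennreal d * b = (\<integral>\<^sup>+t. ennreal (U t) + n t * indicator {0..} t \<partial>lborel)"
    unfolding U_a n_int[symmetric] by (rule nn_integral_add[symmetric]) measurable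
  also have "\<dots> = (\<integral>\<^sup>+t. ennreal (- U t) + p t * indicator {0..} t \<partial>lborel)"
    using nn_integral_pos_neg_part[OF v_int(1)]
    by (intro nn_integral_cong) (auto simp: U n_def p_def split: split_indicator)
  also have "\<dots> = b' + ennreal d * a"
    unfolding U_a p_int[symmetric] by (rule nn_integral_add) measurable
  finally have eq: "a' + ennreal d * b = b' + ennreal d * a" .
  have fin: "a < \<infinity> \<or> b < \<infinity>"
    using w by (simp add: has_time_integral_def ab)
  then have "a' < \<infinity> \<or> b' < \<infinity>"
    using a'_le b'_le by (auto simp: ennreal_mult_less_top intro: le_less_trans)
  then show "has_time_integral u"
    using \<open>U \<in> borel_measurable borel\<close>
    by (simp add: has_time_integral_def set_borel_measurable_def ab U_def[abs_def])
  \<comment> \<open>If \<open>a\<close> is infinite, then \<open>b\<close> and hence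
    \<open>b'\<close> are finite, and \<open>eq\<close> forces \<open>a'\<close> to be infinite. The
    case of infinite \<open>b\<close> is symmetric; otherwise everything is finite.\<close>
  have "enn2ereal a' - enn2ereal b' = ereal d * (enn2ereal a - enn2ereal b)"
    using fin eq a'_le b'_le d
    by (cases a; cases b; cases a'; cases b')
       (auto simp: ennreal_mult_top ennreal_top_mult algebra_simps top_unique
             simp flip: ennreal_mult' ennreal_plus)
  then show "time_integral u = ereal d * time_integral w"
    by (simp add: time_integral_def ab)
qed

section \<open>Comparison of the two Cauchy problems\<close>

lemma (in markov_process) prob_space_kernel: "prob_space (P x)" and sets_kernel: "sets (P x) = sets M"
proof -
  have "x \<in> space borel_del"
    by (simp add: borel_del_def space_measure_of_conv)
  from measurable_space[OF kernel this] show "prob_space (P x)" "sets (P x) = sets M"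
    by (auto simp: space_prob_algebra)
qed

text \<open>Multiplication by \<Phi>'(0) fixes the values 0 and \<infinity> and reverses the
  comparison for negative values, so the strict inequalities are stated for a positive finite time
  integral of \<open>w\<close>.\<close>

theorem theorem5p2:
  fixes m :: "'e::{metric_space, second_countable_topology} measure"
    and M :: "'w measure" and P :: "'e option \<Rightarrow> 'w measure" and X :: "ennreal \<Rightarrow> 'w \<Rightarrow> 'e option"
    and Q :: "'h measure" and H :: "real \<Rightarrow> 'h \<Rightarrow> real"
    and \<nu> :: "real measure" and \<Phi> :: "real \<Rightarrow> real" and c \<Phi>'0 :: real
    and f :: "'e \<Rightarrow> real" and w u :: "real \<Rightarrow> 'e \<Rightarrow> real"
  assumes E: "locally_compact_space (euclidean :: 'e topology)"
    and m: "radon_full_support m"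
    and X: "hunt_process M P X"
    and symmetric: "m_symmetric m P X"
    and regular: "regular_form m (trans_semigroup P X)"
    and symbol: "subordinator_symbol \<nu> \<Phi>"
    and H: "subordinator Q H \<Phi>"
    and limit: "((\<lambda>l. \<Phi> l / l) \<longlongrightarrow> c) (at_right 0)" "0 < c"
    and deriv: "(\<Phi> has_real_derivative \<Phi>'0) (at 0 within {0..})"
    and f: "f \<in> generator_domain m (trans_semigroup P X)"
    and w: "solves_heat m (trans_semigroup P X) f w"
    and u: "solves_Phi_heat m (trans_semigroup P X) \<Phi> f u"
    and w_repr: "\<And>t x. 0 \<le> t \<Longrightarrow>
      has_bochner_integral (P (Some x)) (\<lambda>\<omega>. ext0 f (X (ennreal t) \<omega>)) (w t x)"
    and u_repr: "\<And>t x. 0 \<le> t \<Longrightarrow>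
      has_bochner_integral (P (Some x) \<Otimes>\<^sub>M Q)
        (\<lambda>(\<omega>, \<eta>). ext0 f (X (inverse_subordinator H t \<eta>) \<omega>)) (u t x)"
  shows "\<forall>x. has_time_integral (\<lambda>t. w t x) \<longrightarrow>
    has_time_integral (\<lambda>t. u t x) \<and>
    (\<Phi>'0 < 1 \<longrightarrow> 0 < time_integral (\<lambda>t. w t x) \<longrightarrow> time_integral (\<lambda>t. w t x) < \<infinity> \<longrightarrow>
       time_integral (\<lambda>t. u t x) < time_integral (\<lambda>t. w t x)) \<and>
    (\<Phi>'0 > 1 \<longrightarrow> 0 < time_integral (\<lambda>t. w t x) \<longrightarrow> time_integral (\<lambda>t. w t x) < \<infinity> \<longrightarrow>
       time_integral (\<lambda>t. u t x) > time_integral (\<lambda>t. w t x)) \<and>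
    (\<Phi>'0 = 1 \<longrightarrow> time_integral (\<lambda>t. u t x) = time_integral (\<lambda>t. w t x))"
proof (rule allI, rule impI)
  fix x assume wint: "has_time_integral (\<lambda>t. w t x)"
  interpret subordinator Q H \<Phi> by (rule H)
  interpret X: markov_process M P X
    using X by (rule hunt_process.axioms)
  interpret Px: prob_space "P (Some x)" by (rule X.prob_space_kernel)
  interpret PQ: pair_sigma_finite "P (Some x)" Q ..
  have space_Px: "space (P (Some x)) = space M"
    using X.sets_kernel by (rule sets_eq_imp_space_eq)
  have \<Phi>0: "\<Phi> 0 = 0"
    using symbol by (simp add: subordinator_symbol_def)
  \<comment> \<open>As \<Phi> vanishes at 0, the derivative is the limit \<open>c\<close> of the
    quotients and therefore positive.\<close>
  have "((\<lambda>l. \<Phi> l / l) \<longlongrightarrow> \<Phi>'0) (at 0 within {0..})"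
    using deriv by (simp add: has_field_derivative_iff \<Phi>0)
  then have "((\<lambda>l. \<Phi> l / l) \<longlongrightarrow> \<Phi>'0) (at_right 0)"
    by (rule tendsto_within_subset) auto
  then have "\<Phi>'0 = c"
    using limit(1) by (rule tendsto_unique[OF trivial_limit_at_right_real])
  then have pos: "0 < \<Phi>'0" using limit(2) by simp
  have u': "has_bochner_integral Q (\<lambda>\<eta>. if inverse_subordinator H t \<eta> < \<infinity>
      then w (enn2real (inverse_subordinator H t \<eta>)) x else 0) (u t x)"
    if t: "0 \<le> t" for t
  proof -
    let ?F = "\<lambda>\<omega> \<eta>. ext0 f (X (inverse_subordinator H t \<eta>) \<omega>)"
    have F: "integrable (P (Some x) \<Otimes>\<^sub>M Q) (\<lambda>(\<omega>, \<eta>). ?F \<omega> \<eta>)"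
      "(\<integral>(\<omega>, \<eta>). ?F \<omega> \<eta> \<partial>(P (Some x) \<Otimes>\<^sub>M Q)) = u t x"
      using u_repr[OF t, of x] by (auto simp: has_bochner_integral_iff)
    \<comment> \<open>By Fubini the path of \<open>X\<close> is integrated first, with \<eta> and
      hence the random time held fixed.\<close>
    have "has_bochner_integral Q (\<lambda>\<eta>. \<integral>\<omega>. ?F \<omega> \<eta> \<partial>P (Some x)) (u t x)"
      using PQ.integrable_snd[OF F(1)] PQ.integral_snd[OF F(1)] F(2)
      by (simp add: has_bochner_integral_iff)
    moreover have "(\<integral>\<omega>. ?F \<omega> \<eta> \<partial>P (Some x)) = (if inverse_subordinator H t \<eta> < \<infinity>
        then w (enn2real (inverse_subordinator H t \<eta>)) x else 0)" for \<eta>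
    proof (cases "inverse_subordinator H t \<eta>")
      case (real s)
      then show ?thesis
        using has_bochner_integral_integral_eq[OF w_repr[of s x]] by simp
    next
      \<comment> \<open>At time \<infinity> the process sits in the cemetery, where
        \<open>ext0 f\<close> vanishes; this is the source of the default value 0.\<close>
      case top
      then have "(\<integral>\<omega>. ?F \<omega> \<eta> \<partial>P (Some x)) = (\<integral>\<omega>. 0 \<partial>P (Some x))"
        using X.X_infinity by (intro Bochner_Integration.integral_cong) (auto simp: space_Px ext0_def)
      with top show ?thesis by simp
    qed
    ultimately show ?thesis by simp
  qed
  have main: "has_time_integral (\<lambda>t. u t x)"
    "time_integral (\<lambda>t. u t x) = ereal \<Phi>'0 * time_integral (\<lambda>t. w t x)"
    using u' by (auto intro!: time_integral_subordinated[OF deriv \<Phi>0 pos wint])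
  show "has_time_integral (\<lambda>t. u t x) \<and>
    (\<Phi>'0 < 1 \<longrightarrow> 0 < time_integral (\<lambda>t. w t x) \<longrightarrow> time_integral (\<lambda>t. w t x) < \<infinity> \<longrightarrow>
       time_integral (\<lambda>t. u t x) < time_integral (\<lambda>t. w t x)) \<and>
    (\<Phi>'0 > 1 \<longrightarrow> 0 < time_integral (\<lambda>t. w t x) \<longrightarrow> time_integral (\<lambda>t. w t x) < \<infinity> \<longrightarrow>
       time_integral (\<lambda>t. u t x) > time_integral (\<lambda>t. w t x)) \<and>
    (\<Phi>'0 = 1 \<longrightarrow> time_integral (\<lambda>t. u t x) = time_integral (\<lambda>t. w t x))"
    using main(1) unfolding main(2)
    by (cases "time_integral (\<lambda>t. w t x)") auto
qed

end
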